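(* Let $n\ge 2$ and $\alpha=(n-3)/2$. For $-1<t<1$ let $m(t)=\min\{P_k^{(\alpha,\alpha)}(t): k=0,1,2,\dots\}$. Then $$\lim_{t\to 1} m(t)=2^\alpha\,\Gamma(\alpha+1)\,\frac{J_\alpha(j_{\alpha+1})}{(j_{\alpha+1})^\alpha}.$$
   Context: $P_k^{(\alpha,\alpha)}$ is the Jacobi polynomial of degree $k$ orthogonal on $[-1,1]$ for the weight $(1-u)^\alpha(1+u)^\alpha$, normalized by $P_k^{(\alpha,\alpha)}(1)=1$. $J_\alpha$ is the Bessel function of the first kind of order $\alpha$, and $j_{\alpha+1}$ is the first positive zero of $J_{\alpha+1}$.
   Formalization: The minimum m(t) is read as an infimum over k: for n = 2 one has P_k(cos θ) = cos kθ, and for θ/π irrational the infimum -1 is not attained, so the minimum does not exist; whenever the minimum exists it equals this infimum. *)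

theory Defs
  imports "HOL-Analysis.Analysis" "HOL-Computational_Algebra.Polynomial"
begin

(* has_integral also asserts that the integral exists.  The convention 0 powr a = 0
   affects the weight only at the endpoints, hence not the integral. *)
definition is_jacobi_poly :: "real \<Rightarrow> real \<Rightarrow> nat \<Rightarrow> real poly \<Rightarrow> bool" where
  "is_jacobi_poly \<alpha> \<beta> k p \<longleftrightarrow>
     degree p = k \<and> poly p 1 = 1 \<and>
     (\<forall>q. degree q < k \<longrightarrow>
        ((\<lambda>u. poly p u * poly q u * ((1 - u) powr \<alpha> * (1 + u) powr \<beta>)) has_integral 0) {-1..1})"

(* Normalized to take the value 1 at 1 (not the other common value, k + \<alpha> choose k).
   For \<alpha>, \<beta> > -1 exactly one polynomial satisfies the predicate. *)
definition jacobi_poly :: "real \<Rightarrow> real \<Rightarrow> nat \<Rightarrow> real poly" where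
  "jacobi_poly \<alpha> \<beta> k = (THE p. is_jacobi_poly \<alpha> \<beta> k p)"

(* Intended for x > 0, where powr is the usual real power. *)
definition bessel_J :: "real \<Rightarrow> real \<Rightarrow> real" where
  "bessel_J \<nu> x =
     (\<Sum>m. (-1) ^ m / (fact m * Gamma (real m + \<nu> + 1)) * (x / 2) powr (2 * real m + \<nu>))"

definition bessel_first_zero :: "real \<Rightarrow> real" where
  "bessel_first_zero \<nu> = (LEAST x. x > 0 \<and> bessel_J \<nu> x = 0)"

(* The minimum over k is rendered as an infimum.  For \<alpha> > -1/2 it is attained: for
   fixed t in (-1,1) the sequence P_k(t) tends to 0 and takes negative values.  For \<alpha> = -1/2 we have
   P_k(cos \<theta>) = cos (k \<theta>), and for \<theta>/\<pi> irrational the infimum -1 is not attained. *)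
definition jacobi_min :: "real \<Rightarrow> real \<Rightarrow> real" where
  "jacobi_min \<alpha> t = (INF k. poly (jacobi_poly \<alpha> \<alpha> k) t)"

end

theory Submission
  imports Defs "HOL-Real_Asymp.Real_Asymp"
begin

text \<open>
  Write $A(s) = {}_0F_1(;\alpha+1;-s)$, so that $A(x^2/4)$ is $J_\alpha(x)/x^\alpha$ up to a constant,
  and let $\sigma = j_{\alpha+1}^2/4$, the first zero of $A'$. The limit in question is $A(\sigma)$.
  With $\lambda_k = k(k+2\alpha+1)$, Tannery's theorem on the hypergeometric series gives the
  Mehler--Heine asymptotics $P_k(1 - 2s/\lambda_k) \to A(s)$, locally uniformly in $s$. Choosing $k$ with
  $\lambda_k (1-t)/2 \approx \sigma$ gives the upper bound. For the lower bound no asymptotics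
  for large $s$ are needed: by Sonine's argument the energy $P_k^2 + (1-u^2) P_k'^2/\lambda_k$ is
  nondecreasing in $u$ on $[0,1]$, and at the point with $s = \sigma$ it tends to $A(\sigma)^2$. Hence
  $P_k \ge -|A(\sigma)| - \epsilon = A(\sigma) - \epsilon$ to the left of that point, while to its right
  $P_k$ is close to $A \ge A(\sigma)$; the finitely many small $k$ have $P_k(t) \to 1$.
  That $A(\sigma) \le 0$ holds because $A' < 0$ before its first zero $\sigma$, so that
  $-A(\sigma) = \sigma A''(\sigma) \ge 0$.
\<close>

subsection \<open>The entire part of the Bessel function\<close>

definition bessel_coeff :: "real \<Rightarrow> nat \<Rightarrow> real" where
  "bessel_coeff c m = (-1) ^ m / (pochhammer c m * fact m)"

text \<open>This is ${}_0F_1(;c;-s)$.\<close>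

definition bessel_entire :: "real \<Rightarrow> real \<Rightarrow> real" where
  "bessel_entire c s = (\<Sum>m. bessel_coeff c m * s ^ m)"

lemma bessel_coeff_0 [simp]: "bessel_coeff c 0 = 1"
  by (simp add: bessel_coeff_def)

lemma bessel_coeff_Suc:
  "bessel_coeff c (Suc m) = - bessel_coeff c m / ((c + real m) * (real m + 1))"
  by (simp add: bessel_coeff_def pochhammer_Suc field_simps)

lemma summable_abs_bessel:
  assumes "c > 0"
  shows "summable (\<lambda>m. \<bar>bessel_coeff c m * s ^ m\<bar>)"
proof (rule summable_ratio_test[of "1/2"])
  fix m assume m: "nat \<lceil>2 * \<bar>s\<bar>\<rceil> \<le> m"
  have "2 * \<bar>s\<bar> \<le> real m" using m by linarith
  also have "\<dots> \<le> (c + real m) * (real m + 1)"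
    using assms by (simp add: algebra_simps)
  finally have *: "\<bar>s\<bar> / ((c + real m) * (real m + 1)) \<le> 1/2"
    using assms by (simp add: divide_le_eq)
  have "norm \<bar>bessel_coeff c (Suc m) * s ^ Suc m\<bar> =
      (\<bar>s\<bar> / ((c + real m) * (real m + 1))) * \<bar>bessel_coeff c m * s ^ m\<bar>"
    using assms by (simp add: bessel_coeff_Suc abs_mult)
  also have "\<dots> \<le> 1/2 * \<bar>bessel_coeff c m * s ^ m\<bar>"
    by (intro mult_right_mono *) auto
  finally show "norm \<bar>bessel_coeff c (Suc m) * s ^ Suc m\<bar>
      \<le> 1/2 * norm \<bar>bessel_coeff c m * s ^ m\<bar>" by simp
qed simp

lemma summable_bessel: "c > 0 \<Longrightarrow> summable (\<lambda>m. bessel_coeff c m * s ^ m)"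
  by (rule summable_rabs_cancel[OF summable_abs_bessel])

lemma bessel_entire_0 [simp]: "bessel_entire c 0 = 1"
  using powser_zero[of "bessel_coeff c"] by (simp add: bessel_entire_def)

text \<open>Termwise form of the rule that differentiation raises the parameter by one, from the
  identity (c)_{m+1} = c (c+1)_m.\<close>

lemma diffs_bessel_coeff: "diffs (bessel_coeff c) m = - bessel_coeff (c + 1) m / c"
proof -
  have "real (Suc m) * bessel_coeff c (Suc m) =
      (real (Suc m) / real (Suc m)) * (- bessel_coeff (c + 1) m / c)"
    unfolding bessel_coeff_def pochhammer_rec fact_Suc by (simp del: of_nat_Suc)
  thus ?thesis by (simp add: diffs_def)
qed

lemma bessel_entire_diffs:
  assumes "c > 0"
  shows "(\<Sum>m. diffs (bessel_coeff c) m * s ^ m) = - bessel_entire (c + 1) s / c"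
  using suminf_mult[OF summable_bessel[of "c + 1" s], of "- 1 / c"] assms
  by (simp add: bessel_entire_def diffs_bessel_coeff)

lemma DERIV_bessel_entire:
  assumes "c > 0"
  shows "(bessel_entire c has_real_derivative - bessel_entire (c + 1) s / c) (at s)"
proof -
  have "bessel_entire c = (\<lambda>s. \<Sum>m. bessel_coeff c m * s ^ m)"
    by (simp add: fun_eq_iff bessel_entire_def)
  thus ?thesis
    using termdiffs_strong_converges_everywhere[of "bessel_coeff c" s] summable_bessel[OF assms]
    by (simp only: bessel_entire_diffs[OF assms])
qed

lemma isCont_bessel_entire: "c > 0 \<Longrightarrow> isCont (bessel_entire c) s"
  by (rule DERIV_isCont[OF DERIV_bessel_entire])

lemma continuous_on_bessel_entire: "c > 0 \<Longrightarrow> continuous_on A (bessel_entire c)"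
  by (simp add: continuous_at_imp_continuous_on isCont_bessel_entire)

text \<open>With A = \<open>bessel_entire c\<close> this is the Bessel equation s A'' + c A' + A = 0
  in disguise, because A' is -1/c times \<open>bessel_entire (c + 1)\<close>. The left side is s
  times the derivative of \<open>bessel_entire (c + 1)\<close>. The proof compares
  coefficients.\<close>

lemma bessel_entire_contiguous:
  assumes "c > 0"
  shows "s * (- bessel_entire (c + 2) s / (c + 1)) = c * (bessel_entire c s - bessel_entire (c + 1) s)"
proof -
  let ?f = "\<lambda>m. bessel_coeff (c + 2) m * s ^ m"
  have eq: "c * bessel_coeff c (Suc m) - c * bessel_coeff (c + 1) (Suc m) = - bessel_coeff (c + 2) m / (c + 1)" for m
  proof -
    \<comment> \<open>Both Pochhammer symbols on the left are expressed through \<open>P\<close>,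
      with \<open>q\<close> as the only discrepancy; then c - q = -(m + 1) cancels the denominator m
      + 1.\<close>
    define q where "q = c + 1 + real m"
    define P where "P = pochhammer (c + 2) m"
    have q: "q > 0" and P: "P > 0"
      using assms by (auto simp: q_def P_def intro!: pochhammer_pos)
    have p1: "pochhammer (c + 1) (Suc m) = (c + 1) * P"
      using pochhammer_rec[of "c + 1" m] by (simp add: P_def add.assoc)
    hence "pochhammer (c + 1) m * q = (c + 1) * P"
      by (simp add: pochhammer_Suc[of "c + 1" m] q_def)
    hence "pochhammer (c + 1) m = (c + 1) * P / q"
      using q by (simp add: eq_divide_eq)
    hence p0: "pochhammer c (Suc m) = c * ((c + 1) * P / q)"
      by (simp add: pochhammer_rec)
    have "c * bessel_coeff c (Suc m) = - (q / (real m + 1)) * ((- 1) ^ m / ((c + 1) * P * fact m))"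
      unfolding bessel_coeff_def p0 fact_Suc using assms by (simp add: mult_ac add_ac)
    moreover have "c * bessel_coeff (c + 1) (Suc m) =
        - (c / (real m + 1)) * ((- 1) ^ m / ((c + 1) * P * fact m))"
      unfolding bessel_coeff_def p1 fact_Suc by (simp add: mult_ac add_ac)
    ultimately have "c * bessel_coeff c (Suc m) - c * bessel_coeff (c + 1) (Suc m) =
        ((c - q) / (real m + 1)) * ((- 1) ^ m / ((c + 1) * P * fact m))"
      by (simp only: diff_divide_distrib) (simp only: ring_distribs)
    also have "(c - q) / (real m + 1) = - 1" by (simp add: q_def divide_simps)
    finally show ?thesis by (simp add: bessel_coeff_def P_def)
  qed
  have "(\<lambda>m. c * (bessel_coeff c m * s ^ m) - c * (bessel_coeff (c + 1) m * s ^ m))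
      sums (c * bessel_entire c s - c * bessel_entire (c + 1) s)"
    unfolding bessel_entire_def using assms
    by (intro sums_diff sums_mult summable_sums summable_bessel) auto
  \<comment> \<open>Both series begin with 1, so the constant terms cancel and the index can be
    shifted.\<close>
  hence "(\<lambda>m. c * (bessel_coeff c (Suc m) * s ^ Suc m) - c * (bessel_coeff (c + 1) (Suc m) * s ^ Suc m))
      sums (c * bessel_entire c s - c * bessel_entire (c + 1) s)"
    by (subst sums_Suc_iff) simp
  moreover have term_eq: "c * (bessel_coeff c (Suc m) * s ^ Suc m) - c * (bessel_coeff (c + 1) (Suc m) * s ^ Suc m)
      = (- s / (c + 1)) * ?f m" for m
  proof -
    have "c * (bessel_coeff c (Suc m) * s ^ Suc m) - c * (bessel_coeff (c + 1) (Suc m) * s ^ Suc m)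
        = (c * bessel_coeff c (Suc m) - c * bessel_coeff (c + 1) (Suc m)) * s ^ Suc m"
      by (simp only: left_diff_distrib mult.assoc)
    thus ?thesis unfolding eq by simp
  qed
  ultimately have "(\<lambda>m. (- s / (c + 1)) * ?f m)
      sums (c * bessel_entire c s - c * bessel_entire (c + 1) s)"
    by (simp only: term_eq)
  moreover have "(\<lambda>m. (- s / (c + 1)) * ?f m) sums ((- s / (c + 1)) * bessel_entire (c + 2) s)"
    unfolding bessel_entire_def using assms by (intro sums_mult summable_sums summable_bessel) auto
  ultimately have "c * bessel_entire c s - c * bessel_entire (c + 1) s = (- s / (c + 1)) * bessel_entire (c + 2) s"
    by (rule sums_unique2)
  thus ?thesis by (simp add: algebra_simps)
qed

lemma DERIV_bessel_entire_Suc: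
  assumes "c > 0" "s > 0"
  shows "(bessel_entire (c + 1) has_real_derivative
    c * (bessel_entire c s - bessel_entire (c + 1) s) / s) (at s)"
proof -
  have "c * (bessel_entire c s - bessel_entire (c + 1) s) / s = - bessel_entire (c + 1 + 1) s / (c + 1)"
    using bessel_entire_contiguous[OF assms(1), of s] assms by (simp add: field_simps)
  thus ?thesis using DERIV_bessel_entire[of "c + 1" s] assms by simp
qed

text \<open>Positivity would make the quotient of two contiguous functions solve a Riccati equation
  whose solutions blow up in finite time.\<close>

lemma bessel_entire_has_zero:
  assumes "c > 0"
  shows "\<exists>s>0. bessel_entire (c + 1) s = 0"
proof (rule ccontr)
  assume "\<not> ?thesis"
  hence nz: "bessel_entire (c + 1) s \<noteq> 0" if "s > 0" for s using that by blast
  define A B where "A = bessel_entire c" and "B = bessel_entire (c + 1)"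
  have B0: "B s \<noteq> 0" if "s > 0" for s using nz[OF that] by (simp add: B_def)
  define r where "r = (\<lambda>s. A s / B s)"
  \<comment> \<open>The Riccati equation of the quotient, obtained from A' = -B/c and s B' = c (A -
    B).\<close>
  define r' where "r' = (\<lambda>s. - 1 / c - c * (r s * (r s - 1)) / s)"
  have r: "(r has_real_derivative r' s) (at s)" if "s > 0" for s
  proof -
    have "(A has_real_derivative - B s / c) (at s)"
      unfolding A_def B_def by (rule DERIV_bessel_entire[OF assms])
    moreover have "(B has_real_derivative c * (A s - B s) / s) (at s)"
      unfolding A_def B_def by (rule DERIV_bessel_entire_Suc[OF assms that])
    ultimately have "(r has_real_derivative ((- B s / c) * B s - A s * (c * (A s - B s) / s)) / (B s * B s)) (at s)"
      unfolding r_def using B0[OF that] by (rule DERIV_divide)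
    moreover have "((- B s / c) * B s - A s * (c * (A s - B s) / s)) = r' s * (B s * B s)"
    proof -
      have A: "A s = r s * B s" using B0[OF that] by (simp add: r_def)
      show ?thesis unfolding r'_def A by (simp add: algebra_simps diff_divide_distrib)
    qed
    ultimately show ?thesis using B0[OF that] by simp
  qed
  \<comment> \<open>As r (r - 1) \<ge> -1/4, the second term of \<open>r'\<close> is at most c/(4s),
    and this is at most half of 1/c once s \<ge> c^2/2.\<close>
  define s0 where "s0 = c\<^sup>2 / 2"
  have s0: "s0 > 0" using assms by (simp add: s0_def)
  have r'_le: "r' s \<le> - 1 / (2 * c)" if "s \<ge> s0" for s
  proof -
    have s: "s > 0" using that s0 by linarith
    have "r s * (r s - 1) = (r s - 1/2)\<^sup>2 - 1/4" by (simp add: power2_eq_square algebra_simps)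
    hence "r s * (r s - 1) \<ge> - 1/4" by simp
    hence "c * (r s * (r s - 1)) \<ge> c * (- 1/4)" using assms by (intro mult_left_mono) auto
    hence "c * (r s * (r s - 1)) / s \<ge> c * (- 1/4) / s" using s by (intro divide_right_mono) auto
    moreover have "c / (4 * s) \<le> 1 / (2 * c)"
      using that s assms by (simp add: s0_def field_simps power2_eq_square)
    ultimately show ?thesis unfolding r'_def by (simp add: field_simps)
  qed
  have lin: "r s \<le> r s0 - (s - s0) / (2 * c)" if "s \<ge> s0" for s
  proof -
    have "(\<lambda>x. r x + x / (2 * c)) s0 \<ge> (\<lambda>x. r x + x / (2 * c)) s"
    proof (rule DERIV_nonpos_imp_nonincreasing[OF that])
      fix x assume x: "s0 \<le> x" "x \<le> s"
      have "((\<lambda>x. r x + x / (2 * c)) has_real_derivative (r' x + 1 / (2 * c))) (at x)"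
        using x s0 by (intro DERIV_add r DERIV_cdivide DERIV_ident) auto
      thus "\<exists>y. ((\<lambda>x. r x + x / (2 * c)) has_real_derivative y) (at x) \<and> y \<le> 0"
        using r'_le[OF x(1)] by (intro exI conjI) auto
    qed
    thus ?thesis by (simp add: diff_divide_distrib)
  qed
  \<comment> \<open>Chosen so that the linear bound of slope -1/(2c) has pushed r down to
    -1.\<close>
  define s1 where "s1 = s0 + 2 * c * (\<bar>r s0\<bar> + 1)"
  have s1: "s1 \<ge> s0" using assms by (simp add: s1_def)
  have r1: "r s \<le> - 1" if "s \<ge> s1" for s
  proof -
    have "(s - s0) / (2 * c) \<ge> \<bar>r s0\<bar> + 1" using that assms by (simp add: s1_def field_simps)
    thus ?thesis using lin[of s] that s1 by linarith
  qed
  have s1_pos: "s1 > 0" using s0 s1 by linarith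
  \<comment> \<open>Between \<open>s1\<close> and \<open>s2\<close> the function c ln s grows by
    exactly 1, more than -1/r can make up for while it stays in (0, 1].\<close>
  define s2 where "s2 = s1 * exp (1 / c)"
  have s12: "s1 \<le> s2" using s1_pos assms by (simp add: s2_def)
  \<comment> \<open>For negative r the Riccati equation makes -1/r decrease at least as fast as c ln
    x increases.\<close>
  have "(\<lambda>x. c * ln x - 1 / r x) s2 \<le> (\<lambda>x. c * ln x - 1 / r x) s1"
  proof (rule DERIV_nonpos_imp_nonincreasing[OF s12])
    fix x assume x: "s1 \<le> x" "x \<le> s2"
    have x0: "x > 0" and rx: "r x \<le> - 1" using x s1_pos r1 by auto
    have "((\<lambda>x. c * ln x - 1 / r x) has_real_derivative
        (c * (1 / x) - (0 * r x - 1 * r' x) / (r x * r x))) (at x)"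
      using x0 rx by (intro DERIV_diff DERIV_cmult DERIV_divide r DERIV_const DERIV_ln_divide) auto
    moreover have "c * (1 / x) - (0 * r x - 1 * r' x) / (r x * r x) \<le> 0"
    proof -
      have "c * (1 / x) - (0 * r x - 1 * r' x) / (r x * r x) = - 1 / (c * (r x * r x)) + c / (r x * x)"
      proof -
        have "c * (r x * (r x - 1)) / x / (r x * r x) = c / x - c / (r x * x)"
          using x0 rx by (simp add: divide_simps) (simp add: algebra_simps)
        moreover have "c * (1 / x) - (0 * r x - 1 * r' x) / (r x * r x) =
            c / x - 1 / (c * (r x * r x)) - c * (r x * (r x - 1)) / x / (r x * r x)"
          unfolding r'_def by (simp add: diff_divide_distrib add_divide_distrib)
        ultimately show ?thesis by simp
      qed
      moreover have "c / (r x * x) \<le> 0" using x0 rx assms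
        by (intro divide_nonneg_nonpos mult_nonpos_nonneg) auto
      moreover have "- 1 / (c * (r x * r x)) \<le> 0" using assms by (intro divide_nonpos_nonneg) auto
      ultimately show ?thesis by linarith
    qed
    ultimately show "\<exists>y. ((\<lambda>x. c * ln x - 1 / r x) has_real_derivative y) (at x) \<and> y \<le> 0"
      by blast
  qed
  hence "c * ln s2 - 1 / r s2 \<le> c * ln s1 - 1 / r s1" by simp
  moreover have "c * ln s2 = c * ln s1 + 1"
    using s1_pos assms by (simp add: s2_def ln_mult algebra_simps)
  moreover have "1 / r s2 < 0" using r1[OF s12] by (simp add: divide_neg_neg)
  moreover have "- 1 / r s1 \<le> 1" using r1[of s1] by (simp add: divide_simps)
  ultimately show False by simp
qed

section \<open>The Bessel function and its first positive zero\<close>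

lemma bessel_J_conv_entire:
  assumes "\<nu> > -1" "x > 0"
  shows "bessel_J \<nu> x = (x / 2) powr \<nu> / Gamma (\<nu> + 1) * bessel_entire (\<nu> + 1) (x\<^sup>2 / 4)"
proof -
  have G: "Gamma (\<nu> + 1) > 0" using assms by simp
  have "(-1) ^ m / (fact m * Gamma (real m + \<nu> + 1)) * (x / 2) powr (2 * real m + \<nu>) =
      (x / 2) powr \<nu> / Gamma (\<nu> + 1) * (bessel_coeff (\<nu> + 1) m * (x\<^sup>2 / 4) ^ m)" for m
  proof -
    have "\<nu> + 1 \<notin> \<int>\<^sub>\<le>\<^sub>0" using assms by (auto elim!: nonpos_Ints_cases)
    from pochhammer_Gamma[OF this, of m]
    have "Gamma (real m + \<nu> + 1) = pochhammer (\<nu> + 1) m * Gamma (\<nu> + 1)"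
      using G by (simp add: field_simps)
    moreover have "(x / 2) powr (2 * real m + \<nu>) = (x\<^sup>2 / 4) ^ m * (x / 2) powr \<nu>"
    proof -
      have "(x / 2) powr (2 * real m) = (x / 2) ^ (2 * m)"
        using assms powr_realpow[of "x / 2" "2 * m"] by simp
      also have "\<dots> = (x\<^sup>2 / 4) ^ m" by (simp add: power_mult power_divide)
      finally show ?thesis by (simp add: powr_add)
    qed
    ultimately show ?thesis by (simp add: bessel_coeff_def mult_ac)
  qed
  hence "bessel_J \<nu> x =
      (\<Sum>m. (x / 2) powr \<nu> / Gamma (\<nu> + 1) * (bessel_coeff (\<nu> + 1) m * (x\<^sup>2 / 4) ^ m))"
    by (simp add: bessel_J_def)
  also have "\<dots> = (x / 2) powr \<nu> / Gamma (\<nu> + 1) * bessel_entire (\<nu> + 1) (x\<^sup>2 / 4)"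
    unfolding bessel_entire_def using assms by (intro suminf_mult summable_bessel) auto
  finally show ?thesis .
qed

text \<open>The \<open>LEAST\<close> in the definition is attained: under s = x^2/4 the positive
  zeros of \<open>bessel_J c\<close> become those of \<open>bessel_entire (c + 1)\<close>, whose
  zero set in [0, \<infinity>) is closed, nonempty and does not contain 0. Positivity before the
  first zero follows from the value 1 at 0.\<close>

lemma bessel_first_zeroE:
  assumes "c > 0"
  obtains \<sigma> where "\<sigma> > 0" "bessel_first_zero c = 2 * sqrt \<sigma>"
    "bessel_entire (c + 1) \<sigma> = 0" "\<And>s. 0 \<le> s \<Longrightarrow> s < \<sigma> \<Longrightarrow> bessel_entire (c + 1) s > 0"
proof -
  let ?B = "bessel_entire (c + 1)"
  have c1: "c + 1 > 0" using assms by simp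
  define Z where "Z = {s. s \<ge> 0 \<and> ?B s = 0}"
  define \<sigma> where "\<sigma> = Inf Z"
  have "Z = {0..} \<inter> ?B -` {0}" by (auto simp: Z_def)
  hence "closed Z"
    using continuous_closed_vimage[of "{0}" ?B] isCont_bessel_entire[OF c1] by auto
  moreover obtain s0 where "s0 > 0" "?B s0 = 0" using bessel_entire_has_zero[OF assms] by blast
  hence "Z \<noteq> {}" by (auto simp: Z_def intro!: exI[of _ s0])
  moreover have bdd: "bdd_below Z" by (auto simp: Z_def)
  ultimately have "\<sigma> \<in> Z" unfolding \<sigma>_def by (intro closed_contains_Inf)
  hence \<sigma>0: "\<sigma> \<ge> 0" and B0: "?B \<sigma> = 0" by (auto simp: Z_def)
  with bessel_entire_0[of "c + 1"] have \<sigma>: "\<sigma> > 0" by (cases "\<sigma> = 0") auto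
  have nz: "\<sigma> \<le> s" if "s \<ge> 0" "?B s = 0" for s
    unfolding \<sigma>_def using that bdd by (intro cInf_lower) (auto simp: Z_def)
  have pos: "?B s > 0" if s: "0 \<le> s" "s < \<sigma>" for s
  proof (rule ccontr)
    assume "\<not> ?B s > 0"
    then obtain t where "0 \<le> t" "t \<le> s" "?B t = 0"
      using IVT2'[of ?B s 0 0] s continuous_on_bessel_entire[OF c1] by auto
    with nz[of t] s show False by simp
  qed
  have J0: "bessel_J c x = 0 \<longleftrightarrow> ?B (x\<^sup>2 / 4) = 0" if "x > 0" for x
  proof -
    have "Gamma (c + 1) \<noteq> 0" using Gamma_real_pos[OF c1] by linarith
    thus ?thesis using that assms by (simp add: bessel_J_conv_entire)
  qed
  have "bessel_first_zero c = 2 * sqrt \<sigma>"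
    unfolding bessel_first_zero_def
  proof (rule Least_equality)
    show "2 * sqrt \<sigma> > 0 \<and> bessel_J c (2 * sqrt \<sigma>) = 0"
      using \<sigma> B0 by (simp add: J0 power_mult_distrib)
    fix x assume x: "x > 0 \<and> bessel_J c x = 0"
    hence "\<sigma> \<le> x\<^sup>2 / 4" by (intro nz) (auto simp: J0)
    hence "sqrt \<sigma> \<le> sqrt ((x / 2)\<^sup>2)" by (intro real_sqrt_le_mono) (simp add: power_divide)
    thus "2 * sqrt \<sigma> \<le> x" using x by simp
  qed
  with \<sigma> B0 pos show ?thesis using that by blast
qed

subsection \<open>Ultraspherical polynomials\<close>

text \<open>Eigenvalue of p \<mapsto> -(1 - u^2) p'' + 2 (\<alpha> + 1) u p' on the ultraspherical
  polynomial of degree k.\<close>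

definition jacobi_ev :: "real \<Rightarrow> nat \<Rightarrow> real" where
  "jacobi_ev \<alpha> k = real k * (real k + 2 * \<alpha> + 1)"

text \<open>Since $(-k)_m (k+2\alpha+1)_m = \prod_{i<m} (\lambda_i - \lambda_k)$ with $\lambda_i$ the eigenvalue
  \<open>jacobi_ev \<alpha> i\<close>, these are the coefficients of ${}_2F_1(-k, k+2\alpha+1; \alpha+1; w)$; the argument is
  $w = (1-u)/2$.\<close>

definition ultra_coeff :: "real \<Rightarrow> nat \<Rightarrow> nat \<Rightarrow> real" where
  "ultra_coeff \<alpha> k m = (\<Prod>i<m. jacobi_ev \<alpha> i - jacobi_ev \<alpha> k) / (pochhammer (\<alpha> + 1) m * fact m)"

definition ultra_poly :: "real \<Rightarrow> nat \<Rightarrow> real poly" where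
  "ultra_poly \<alpha> k = (\<Sum>m\<le>k. monom (ultra_coeff \<alpha> k m) m)"

lemma jacobi_ev_less: "\<alpha> > -1 \<Longrightarrow> i < k \<Longrightarrow> jacobi_ev \<alpha> i < jacobi_ev \<alpha> k"
proof -
  assume *: "\<alpha> > -1" "i < k"
  have "jacobi_ev \<alpha> k - jacobi_ev \<alpha> i = (real k - real i) * (real k + real i + 2 * \<alpha> + 1)"
    by (simp add: jacobi_ev_def algebra_simps)
  also have "\<dots> > 0" using * by (intro mult_pos_pos) auto
  finally show ?thesis by simp
qed

lemma jacobi_ev_0 [simp]: "jacobi_ev \<alpha> 0 = 0"
  by (simp add: jacobi_ev_def)

lemma ultra_coeff_eq_0: "m > k \<Longrightarrow> ultra_coeff \<alpha> k m = 0"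
  by (force simp: ultra_coeff_def)

lemma coeff_ultra_poly [simp]: "coeff (ultra_poly \<alpha> k) m = ultra_coeff \<alpha> k m"
  by (auto simp: ultra_poly_def coeff_sum ultra_coeff_eq_0 not_le)

lemma ultra_coeff_Suc:
  assumes "\<alpha> > -1"
  shows "(real m + 1) * (real m + \<alpha> + 1) * ultra_coeff \<alpha> k (Suc m) =
    (jacobi_ev \<alpha> m - jacobi_ev \<alpha> k) * ultra_coeff \<alpha> k m"
proof -
  have "real m + \<alpha> + 1 \<noteq> 0" using assms by linarith
  moreover have "ultra_coeff \<alpha> k (Suc m) = (jacobi_ev \<alpha> m - jacobi_ev \<alpha> k) * ultra_coeff \<alpha> k m /
      ((real m + 1) * (real m + \<alpha> + 1))"
    by (simp add: ultra_coeff_def pochhammer_Suc mult_ac add_ac)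
  ultimately show ?thesis by simp
qed

text \<open>The hypergeometric equation in the variable w. The coefficient of w^n on the left
  vanishes by the recurrence \<open>ultra_coeff_Suc\<close>.\<close>

lemma ultra_poly_ode:
  fixes \<alpha> w :: real and k :: nat
  assumes "\<alpha> > -1"
  defines "Q \<equiv> ultra_poly \<alpha> k"
  shows "w * (1 - w) * poly (pderiv (pderiv Q)) w + (\<alpha> + 1) * (1 - 2 * w) * poly (pderiv Q) w
    + jacobi_ev \<alpha> k * poly Q w = 0"
proof -
  \<comment> \<open>\<open>pCons 0\<close> is multiplication by the variable, so these are the Euler
    operators w d/dw and w^2 d^2/dw^2 on coefficients.\<close>
  have cf: "coeff (pCons 0 (pderiv p)) n = real n * coeff p n" for p :: "real poly" and n
    by (cases n) (auto simp: coeff_pderiv)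
  have cf2: "coeff (pCons 0 (pCons 0 (pderiv (pderiv p)))) n = real n * (real n - 1) * coeff p n"
    for p :: "real poly" and n
    by (cases n) (auto simp: cf coeff_pderiv)
  have "pCons 0 (pderiv (pderiv Q)) - pCons 0 (pCons 0 (pderiv (pderiv Q)))
      + smult (\<alpha> + 1) (pderiv Q - smult 2 (pCons 0 (pderiv Q))) + smult (jacobi_ev \<alpha> k) Q = 0"
    (is "?P = 0")
  proof (rule poly_eqI)
    fix n
    have "coeff ?P n = (real n + 1) * (real n + \<alpha> + 1) * ultra_coeff \<alpha> k (Suc n)
        - (jacobi_ev \<alpha> n - jacobi_ev \<alpha> k) * ultra_coeff \<alpha> k n"
      unfolding coeff_add coeff_diff coeff_smult cf cf2
      by (simp add: Q_def coeff_pderiv jacobi_ev_def[of _ n] algebra_simps)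
    thus "coeff ?P n = coeff 0 n" using ultra_coeff_Suc[OF assms(1)] by simp
  qed
  hence "poly ?P w = 0" by simp
  thus ?thesis by (simp add: algebra_simps)
qed

section \<open>Orthogonality and uniqueness of the Jacobi polynomials\<close>

text \<open>Symmetry of L for the weight: the integrand is the derivative of (1 - u^2)^(\<alpha>+1)
  (p' q - p q'), which vanishes at both endpoints since \<alpha> + 1 > 0.\<close>

lemma ultra_weight_green:
  fixes p q :: "real poly" and \<alpha> :: real
  assumes "\<alpha> > -1"
  defines "L \<equiv> \<lambda>p u. (1 - u\<^sup>2) * poly (pderiv (pderiv p)) u - 2 * (\<alpha> + 1) * u * poly (pderiv p) u"
  shows "((\<lambda>u. (L p u * poly q u - poly p u * L q u) * ((1 - u) powr \<alpha> * (1 + u) powr \<alpha>))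
    has_integral 0) {-1..1}"
proof -
  define H where "H = (\<lambda>u. ((1 - u) powr (\<alpha> + 1) * (1 + u) powr (\<alpha> + 1)) *
    (poly (pderiv p) u * poly q u - poly p u * poly (pderiv q) u))"
  have "((\<lambda>u. (L p u * poly q u - poly p u * L q u) * ((1 - u) powr \<alpha> * (1 + u) powr \<alpha>))
    has_integral (H 1 - H (-1))) {-1..1}"
  \<comment> \<open>The weight may be singular at the endpoints; this form asks for
    differentiability in the open interval and continuity of H on the closed one.\<close>
  proof (rule fundamental_theorem_of_calculus_interior)
    show "continuous_on {-1..1} H"
      unfolding H_def using assms(1)
      by (intro continuous_intros continuous_on_powr') auto
    fix u :: real assume u: "u \<in> {-1<..<1}"
    define D where "D = poly (pderiv p) u * poly q u - poly p u * poly (pderiv q) u"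
    define D' where "D' = poly (pderiv (pderiv p)) u * poly q u - poly p u * poly (pderiv (pderiv q)) u"
    have "(H has_real_derivative
       ((- (\<alpha> + 1) * (1 - u) powr \<alpha>) * (1 + u) powr (\<alpha> + 1)
          + (1 - u) powr (\<alpha> + 1) * ((\<alpha> + 1) * (1 + u) powr \<alpha>)) * D
        + ((1 - u) powr (\<alpha> + 1) * (1 + u) powr (\<alpha> + 1)) * D') (at u)"
      unfolding H_def D_def D'_def using u
      by (auto intro!: derivative_eq_intros simp: algebra_simps)
    moreover have "((- (\<alpha> + 1) * (1 - u) powr \<alpha>) * (1 + u) powr (\<alpha> + 1)
          + (1 - u) powr (\<alpha> + 1) * ((\<alpha> + 1) * (1 + u) powr \<alpha>)) * D
        + ((1 - u) powr (\<alpha> + 1) * (1 + u) powr (\<alpha> + 1)) * D' =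
        ((1 - u\<^sup>2) * D' - 2 * (\<alpha> + 1) * u * D) * ((1 - u) powr \<alpha> * (1 + u) powr \<alpha>)"
    proof -
      have pw: "(1 - u) powr (\<alpha> + 1) = (1 - u) * (1 - u) powr \<alpha>"
        "(1 + u) powr (\<alpha> + 1) = (1 + u) * (1 + u) powr \<alpha>"
        using u by (simp_all add: powr_add)
      show ?thesis unfolding pw by (simp add: algebra_simps power2_eq_square)
    qed
    ultimately have "(H has_real_derivative
        ((1 - u\<^sup>2) * D' - 2 * (\<alpha> + 1) * u * D) * ((1 - u) powr \<alpha> * (1 + u) powr \<alpha>)) (at u)"
      by simp
    thus "(H has_vector_derivative (L p u * poly q u - poly p u * L q u) *
        ((1 - u) powr \<alpha> * (1 + u) powr \<alpha>)) (at u)"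
      unfolding has_real_derivative_iff_has_vector_derivative L_def D_def D'_def
      by (simp add: algebra_simps)
  qed simp
  thus ?thesis using assms(1) by (simp add: H_def)
qed

text \<open>Since L u^d = d (d - 1) u^(d-2) - \<lambda>_d u^d, Green's identity and induction on d
  leave (\<lambda>_d - \<lambda>_k) times the integral equal to 0, and the two eigenvalues
  differ.\<close>

lemma ultra_weight_orthogonal_monom:
  fixes p :: "real poly" and \<alpha> :: real
  assumes "\<alpha> > -1"
  assumes ode: "\<And>u. (1 - u\<^sup>2) * poly (pderiv (pderiv p)) u - 2 * (\<alpha> + 1) * u * poly (pderiv p) u
    = - jacobi_ev \<alpha> k * poly p u"
  shows "d < k \<Longrightarrow> ((\<lambda>u. poly p u * u ^ d * ((1 - u) powr \<alpha> * (1 + u) powr \<alpha>)) has_integral 0) {-1..1}"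
proof (induction d rule: less_induct)
  case (less d)
  let ?w = "\<lambda>u. (1 - u) powr \<alpha> * (1 + u) powr \<alpha>"
  let ?q = "monom 1 d :: real poly"
  have q: "(1 - u\<^sup>2) * poly (pderiv (pderiv ?q)) u - 2 * (\<alpha> + 1) * u * poly (pderiv ?q) u
      = real d * (real d - 1) * u ^ (d - 2) - jacobi_ev \<alpha> d * u ^ d" for u
  proof -
    consider "d = 0" | "d = 1" | e where "d = Suc (Suc e)" by (metis One_nat_def not0_implies_Suc)
    thus ?thesis
      by cases (auto simp: pderiv_monom poly_monom jacobi_ev_def algebra_simps power2_eq_square)
  qed
  \<comment> \<open>For d < 2 the subtraction d - 2 truncates to 0, but then the factor d (d - 1)
    vanishes.\<close>
  have "((\<lambda>u. poly p u * u ^ (d - 2) * ?w u * (real d * (real d - 1))) has_integral 0) {-1..1}"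
  proof (cases "d < 2")
    case True
    hence "d = 0 \<or> d = 1" by linarith
    thus ?thesis by (elim disjE) simp_all
  next
    case False
    hence "((\<lambda>u. poly p u * u ^ (d - 2) * ?w u) has_integral 0) {-1..1}"
      using less by simp
    from has_integral_mult_left[OF this] show ?thesis by simp
  qed
  from has_integral_add[OF ultra_weight_green[OF assms(1), of p ?q] this]
  have "((\<lambda>u. (jacobi_ev \<alpha> d - jacobi_ev \<alpha> k) * (poly p u * u ^ d * ?w u)) has_integral 0) {-1..1}"
    unfolding q ode by (simp add: poly_monom algebra_simps)
  from has_integral_mult_right[OF this, of "1 / (jacobi_ev \<alpha> d - jacobi_ev \<alpha> k)"]
  show ?case using jacobi_ev_less[OF assms(1) less.prems] by simp
qed

text \<open>The degree is k because the top coefficient is built from nonzero eigenvalue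
  differences; u = 1 corresponds to w = 0; orthogonality passes from monomials to q by
  linearity.\<close>

lemma ultra_poly_is_jacobi:
  assumes "\<alpha> > -1"
  shows "is_jacobi_poly \<alpha> \<alpha> k (ultra_poly \<alpha> k \<circ>\<^sub>p [:1/2, -1/2:])"
proof -
  let ?Q = "ultra_poly \<alpha> k"
  let ?p = "?Q \<circ>\<^sub>p [:1/2, -1/2:]"
  let ?l = "[:1/2, -1/2:] :: real poly"
  let ?w = "\<lambda>u. (1 - u) powr \<alpha> * (1 + u) powr \<alpha>"
  have "ultra_coeff \<alpha> k k \<noteq> 0"
  proof -
    have "pochhammer (\<alpha> + 1) k > 0" using assms by (intro pochhammer_pos) auto
    moreover have "jacobi_ev \<alpha> i - jacobi_ev \<alpha> k \<noteq> 0" if "i < k" for i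
      using jacobi_ev_less[OF assms that] by simp
    ultimately show ?thesis by (auto simp: ultra_coeff_def)
  qed
  hence "degree ?Q = k"
    by (intro antisym degree_le le_degree) (auto simp: ultra_coeff_eq_0)
  hence "degree ?p = k" by (simp add: degree_pcompose)
  moreover have "poly ?p 1 = 1"
    by (simp add: poly_pcompose poly_0_coeff_0 ultra_coeff_def)
  moreover have "((\<lambda>u. poly ?p u * poly q u * ?w u) has_integral 0) {-1..1}" if "degree q < k" for q
  proof -
    \<comment> \<open>The substitution u = 1 - 2v turns 1 - u^2 into 4v(1 - v), and every
      u-derivative contributes a factor -1/2.\<close>
    have ode: "(1 - u\<^sup>2) * poly (pderiv (pderiv ?p)) u - 2 * (\<alpha> + 1) * u * poly (pderiv ?p) u
        = - jacobi_ev \<alpha> k * poly ?p u" for u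
    proof -
      define v where "v = 1/2 - u/2"
      have u: "u = 1 - 2 * v" by (simp add: v_def)
      have pd: "pderiv (r \<circ>\<^sub>p ?l) = smult (-1/2) (pderiv r \<circ>\<^sub>p ?l)" for r
        by (simp add: pderiv_pcompose pderiv_pCons)
      have "poly ?p u = poly ?Q v" "poly (pderiv ?p) u = - poly (pderiv ?Q) v / 2"
        "poly (pderiv (pderiv ?p)) u = poly (pderiv (pderiv ?Q)) v / 4"
        unfolding pd pderiv_smult poly_smult poly_pcompose by (simp_all add: v_def)
      thus ?thesis
        using ultra_poly_ode[OF assms, of v k] unfolding u
        by (simp add: algebra_simps add_divide_distrib power2_eq_square)
    qed
    have "((\<lambda>u. \<Sum>d\<le>degree q. poly ?p u * u ^ d * ?w u * coeff q d) has_integral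
        (\<Sum>d\<le>degree q. 0 * coeff q d)) {-1..1}"
      using that by (intro has_integral_sum has_integral_mult_left
          ultra_weight_orthogonal_monom[OF assms ode]) auto
    moreover have "(\<Sum>d\<le>degree q. poly ?p u * u ^ d * ?w u * coeff q d) = poly ?p u * poly q u * ?w u" for u
      unfolding poly_altdef[of q] sum_distrib_left sum_distrib_right by (simp add: mult_ac)
    ultimately show ?thesis by simp
  qed
  ultimately show ?thesis by (simp add: is_jacobi_poly_def)
qed

text \<open>A nonnegative integrand with integral 0 also has integral 0 on compact subintervals of
  (-1, 1). There it is continuous with positive weight, so d vanishes on all of (-1, 1) and has
  infinitely many roots.\<close>

lemma ultra_weight_square_eq_0:
  fixes d :: "real poly"
  assumes "((\<lambda>u. poly d u * poly d u * ((1 - u) powr \<alpha> * (1 + u) powr \<alpha>)) has_integral 0) {-1..1}"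
    (is "(?f has_integral 0) _")
  shows "d = 0"
proof (rule ccontr)
  assume "d \<noteq> 0"
  have "poly d x = 0" if x: "x \<in> {-1<..<1}" for x
  proof -
    \<comment> \<open>A radius strictly between |x| and 1 keeps the interval away from the
      endpoints.\<close>
    define r where "r = (1 + \<bar>x\<bar>) / 2"
    have r: "\<bar>x\<bar> < r" "0 < r" "r < 1" using x by (auto simp: r_def)
    have int: "?f integrable_on {-1..1}" using assms by (rule has_integral_integrable)
    have sub: "{-r..r} \<subseteq> {-1..1}" using r by auto
    have nonneg: "0 \<le> ?f u" for u by simp
    have "?f integrable_on {-r..r}" by (rule integrable_on_subinterval[OF int sub])
    moreover from this have "integral {-r..r} ?f \<le> integral {-1..1} ?f"
      by (intro integral_subset_le[OF sub _ int] ballI nonneg)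
    moreover from calculation have "integral {-r..r} ?f \<ge> 0"
      by (intro integral_nonneg nonneg)
    moreover have "integral {-1..1} ?f = 0" using assms by (rule integral_unique)
    ultimately have "(?f has_integral 0) (cbox (-r) r)"
      by (simp add: has_integral_iff)
    moreover have "continuous_on (cbox (-r) r) ?f"
      using r by (intro continuous_intros) auto
    ultimately have "?f x = 0"
      using r by (intro has_integral_0_cbox_imp_0[of "-r" r ?f]) auto
    thus ?thesis using x by simp
  qed
  hence "{-1<..<1} \<subseteq> {x. poly d x = 0}" by blast
  with poly_roots_finite[OF \<open>d \<noteq> 0\<close>] have "finite {-1<..<1::real}" by (rule finite_subset[rotated])
  thus False using infinite_Ioo[of "-1::real" 1] by simp
qed

text \<open>The combination d of p and q that cancels the leading terms has degree below k, so it is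
  orthogonal to p and q and thus to itself. Hence d = 0, and the value at 1 fixes the
  factor.\<close>

lemma is_jacobi_poly_unique:
  assumes p: "is_jacobi_poly \<alpha> \<alpha> k p" and q: "is_jacobi_poly \<alpha> \<alpha> k q"
  shows "p = q"
proof (cases "k = 0")
  case True
  thus ?thesis using p q by (auto simp: is_jacobi_poly_def elim!: degree_eq_zeroE)
next
  case False
  let ?w = "\<lambda>u. (1 - u) powr \<alpha> * (1 + u) powr \<alpha>"
  have deg: "degree p = k" "degree q = k" and at1: "poly p 1 = 1" "poly q 1 = 1"
    using p q by (auto simp: is_jacobi_poly_def)
  define a b where "a = lead_coeff q" and "b = lead_coeff p"
  have "a \<noteq> 0" unfolding a_def using at1 by auto
  define d where "d = smult a p - smult b q"
  have "degree d \<le> k" unfolding d_def using deg by (intro degree_diff_le) (auto intro: order_trans[OF degree_smult_le])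
  moreover have "coeff d k = 0" using deg by (simp add: d_def a_def b_def)
  \<comment> \<open>The zero polynomial has degree 0, so this inference requires k \<noteq> 0;
    constants are treated separately above.\<close>
  moreover from this have "degree d \<noteq> k" using False by (metis degree_0 leading_coeff_0_iff)
  ultimately have "degree d < k" by simp
  hence "((\<lambda>u. a * (poly p u * poly d u * ?w u) - b * (poly q u * poly d u * ?w u)) has_integral
      (a * 0 - b * 0)) {-1..1}"
    using p q by (intro has_integral_diff has_integral_mult_right) (auto simp: is_jacobi_poly_def)
  moreover have "a * (poly p u * poly d u * ?w u) - b * (poly q u * poly d u * ?w u) =
      poly d u * poly d u * ?w u" for u
    by (simp add: d_def algebra_simps)
  ultimately have "((\<lambda>u. poly d u * poly d u * ?w u) has_integral 0) {-1..1}" by simp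
  hence "d = 0" by (rule ultra_weight_square_eq_0)
  hence eq: "smult a p = smult b q" by (simp add: d_def)
  from arg_cong[OF this, of "\<lambda>r. poly r 1"] have "a = b" using at1 by simp
  with arg_cong[OF eq, of "smult (1 / a)"] \<open>a \<noteq> 0\<close> show ?thesis by simp
qed

lemma jacobi_poly_conv_ultra:
  assumes "\<alpha> > -1"
  shows "poly (jacobi_poly \<alpha> \<alpha> k) t = poly (ultra_poly \<alpha> k) ((1 - t) / 2)"
proof -
  have "jacobi_poly \<alpha> \<alpha> k = ultra_poly \<alpha> k \<circ>\<^sub>p [:1/2, -1/2:]"
    unfolding jacobi_poly_def
    using ultra_poly_is_jacobi[OF assms] is_jacobi_poly_unique by (intro the_equality) blast+
  thus ?thesis by (simp add: poly_pcompose diff_divide_distrib)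
qed

lemma jacobi_ev_pos: "\<alpha> > -1 \<Longrightarrow> k > 0 \<Longrightarrow> jacobi_ev \<alpha> k > 0"
  using jacobi_ev_less[of \<alpha> 0 k] by simp

section \<open>Sonine's energy function\<close>

text \<open>In the variable u this is P_k^2 + (1 - u^2) P_k'^2 / \<lambda>_k: here w (1 - w) = (1 -
  u^2)/4, while the squared derivative gains a factor 4.\<close>

definition ultra_energy :: "real \<Rightarrow> nat \<Rightarrow> real \<Rightarrow> real" where
  "ultra_energy \<alpha> k w = (poly (ultra_poly \<alpha> k) w)\<^sup>2 +
     w * (1 - w) * (poly (pderiv (ultra_poly \<alpha> k)) w)\<^sup>2 / jacobi_ev \<alpha> k"

text \<open>After elimination of the second derivative by the differential equation, \<lambda>_k
  times the derivative of the energy is -(2\<alpha> + 1)(1 - 2w) q'^2. Its sign uses both \<alpha>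
  \<ge> -1/2 and w \<le> 1/2.\<close>

lemma ultra_energy_antimono:
  assumes "\<alpha> \<ge> -1/2" "k > 0" "v \<le> w" "w \<le> 1/2"
  shows "ultra_energy \<alpha> k w \<le> ultra_energy \<alpha> k v"
proof (rule DERIV_nonpos_imp_nonincreasing[OF assms(3)])
  fix x assume x: "v \<le> x" "x \<le> w"
  define l where "l = jacobi_ev \<alpha> k"
  have l: "l > 0" unfolding l_def using assms by (intro jacobi_ev_pos) auto
  define q q' q'' where "q = poly (ultra_poly \<alpha> k)" and "q' = poly (pderiv (ultra_poly \<alpha> k))"
    and "q'' = poly (pderiv (pderiv (ultra_poly \<alpha> k)))"
  have dq: "(q has_real_derivative q' x) (at x)" "(q' has_real_derivative q'' x) (at x)"
    unfolding q_def q'_def q''_def by (rule poly_DERIV)+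
  have "x * (1 - x) * q'' x + (\<alpha> + 1) * (1 - 2 * x) * q' x + l * q x = 0"
    unfolding l_def q_def q'_def q''_def using assms by (intro ultra_poly_ode) auto
  hence ode: "l * q x = - (x * (1 - x) * q'' x) - (\<alpha> + 1) * (1 - 2 * x) * q' x" by linarith
  define D where "D = 2 * q x * q' x + ((1 - 2 * x) * (q' x)\<^sup>2 + x * (1 - x) * (2 * q' x * q'' x)) / l"
  have "((\<lambda>w. (q w)\<^sup>2) has_real_derivative 2 * q x * q' x) (at x)"
    using dq by (auto intro!: derivative_eq_intros)
  moreover have "((\<lambda>w. w * (1 - w) * (q' w)\<^sup>2) has_real_derivative
      (1 - 2 * x) * (q' x)\<^sup>2 + x * (1 - x) * (2 * q' x * q'' x)) (at x)"
    using dq by (auto intro!: derivative_eq_intros simp: algebra_simps)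
  ultimately have "((\<lambda>w. (q w)\<^sup>2 + w * (1 - w) * (q' w)\<^sup>2 / l) has_real_derivative D) (at x)"
    unfolding D_def by (intro DERIV_add DERIV_cdivide)
  moreover have "ultra_energy \<alpha> k = (\<lambda>w. (q w)\<^sup>2 + w * (1 - w) * (q' w)\<^sup>2 / l)"
    by (simp add: fun_eq_iff ultra_energy_def q_def q'_def l_def)
  moreover have "D \<le> 0"
  proof -
    have "l * D = 2 * q' x * (l * q x) + ((1 - 2 * x) * (q' x)\<^sup>2 + x * (1 - x) * (2 * q' x * q'' x))"
      using l by (simp add: D_def distrib_left add_divide_distrib)
    also have "\<dots> = - ((2 * \<alpha> + 1) * (1 - 2 * x) * (q' x)\<^sup>2)"
      unfolding ode by (simp add: algebra_simps power2_eq_square)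
    also have "\<dots> \<le> 0" using assms x by simp
    finally show ?thesis using l by (simp add: mult_le_0_iff)
  qed
  ultimately show "\<exists>y. (ultra_energy \<alpha> k has_real_derivative y) (at x) \<and> y \<le> 0" by auto
qed

lemma ultra_poly_sq_le_energy:
  assumes "\<alpha> > -1" "0 \<le> w" "w \<le> 1"
  shows "(poly (ultra_poly \<alpha> k) w)\<^sup>2 \<le> ultra_energy \<alpha> k w"
proof -
  have "jacobi_ev \<alpha> k \<ge> 0" using jacobi_ev_pos[OF assms(1)] by (cases "k = 0") (auto intro: less_imp_le)
  thus ?thesis using assms by (simp add: ultra_energy_def)
qed

lemma ultra_poly_at_0: "poly (ultra_poly \<alpha> k) 0 = 1"
  by (simp add: poly_0_coeff_0 ultra_coeff_def)

text \<open>For k > 0 the energy at w = 0 equals 1 and bounds the square from above. The bound is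
  uniform in k, so the infimum over k is taken over a set bounded below.\<close>

lemma ultra_poly_ge_minus_1:
  assumes "\<alpha> \<ge> -1/2" "0 \<le> w" "w \<le> 1/2"
  shows "poly (ultra_poly \<alpha> k) w \<ge> -1"
proof (cases "k = 0")
  case True
  thus ?thesis by (simp add: ultra_poly_def ultra_coeff_def poly_monom)
next
  case False
  have "(poly (ultra_poly \<alpha> k) w)\<^sup>2 \<le> ultra_energy \<alpha> k w"
    using assms by (intro ultra_poly_sq_le_energy) auto
  also have "\<dots> \<le> ultra_energy \<alpha> k 0"
    using False assms by (intro ultra_energy_antimono) auto
  also have "\<dots> = 1" by (simp add: ultra_energy_def ultra_poly_at_0)
  finally have "\<bar>poly (ultra_poly \<alpha> k) w\<bar> \<le> 1" by (simp add: abs_square_le_1)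
  thus ?thesis by linarith
qed

section \<open>Limits of power series with damped coefficients\<close>

text \<open>For |s| \<le> S the two sums differ by at most the sum of |a_m S^m| (1 - c k m). This
  bound is free of s and tends to 0 by Tannery's theorem, with dominating terms |a_m S^m|.\<close>

lemma uniform_limit_powser_multiplier:
  fixes a :: "nat \<Rightarrow> real" and c :: "nat \<Rightarrow> nat \<Rightarrow> real"
  assumes sm: "summable (\<lambda>m. \<bar>a m * S ^ m\<bar>)" and c: "\<And>k m. 0 \<le> c k m" "\<And>k m. c k m \<le> 1"
    and lim: "\<And>m. (\<lambda>k. c k m) \<longlonglongrightarrow> 1"
  shows "uniform_limit {-S..S} (\<lambda>k s. \<Sum>m. a m * c k m * s ^ m) (\<lambda>s. \<Sum>m. a m * s ^ m) sequentially"
proof (rule uniform_limitI)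
  define \<delta> where "\<delta> = (\<lambda>k. \<Sum>m. \<bar>a m * S ^ m\<bar> * (1 - c k m))"
  have bd: "\<bar>a m * S ^ m\<bar> * (1 - c k m) \<le> \<bar>a m * S ^ m\<bar>" for k m
    using mult_left_mono[of "1 - c k m" 1 "\<bar>a m * S ^ m\<bar>"] c by simp
  have "\<delta> \<longlonglongrightarrow> (\<Sum>m::nat. 0)"
    unfolding \<delta>_def
  proof (rule tannerys_theorem[THEN conjunct2, THEN conjunct2])
    show "(\<lambda>k. \<bar>a m * S ^ m\<bar> * (1 - c k m)) \<longlonglongrightarrow> 0" for m
      using tendsto_mult[OF tendsto_const tendsto_diff[OF tendsto_const lim[of m]],
          of "\<bar>a m * S ^ m\<bar>" 1] by simp
    show "\<forall>\<^sub>F (m, k) in sequentially \<times>\<^sub>F sequentially.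
        norm (\<bar>a m * S ^ m\<bar> * (1 - c k m)) \<le> \<bar>a m * S ^ m\<bar>"
      using c bd by (intro always_eventually) (auto simp: abs_mult)
  qed (use sm in auto)
  hence lim0: "\<delta> \<longlonglongrightarrow> 0" by simp
  fix e :: real assume "e > 0"
  from order_tendstoD(2)[OF lim0 this]
  show "\<forall>\<^sub>F k in sequentially. \<forall>s\<in>{-S..S}. dist (\<Sum>m. a m * c k m * s ^ m) (\<Sum>m. a m * s ^ m) < e"
  proof eventually_elim
    case (elim k)
    show ?case
    proof
      fix s assume s: "s \<in> {-S..S}"
      have le: "\<bar>a m * s ^ m\<bar> \<le> \<bar>a m * S ^ m\<bar>" for m
      proof -
        have "\<bar>s\<bar> ^ m \<le> \<bar>S\<bar> ^ m" using s by (intro power_mono) auto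
        thus ?thesis by (simp add: abs_mult power_abs mult_left_mono)
      qed
      have s1: "summable (\<lambda>m. a m * s ^ m)"
        by (rule summable_comparison_test'[OF sm]) (use le in simp)
      have s2: "summable (\<lambda>m. a m * c k m * s ^ m)"
      proof (rule summable_comparison_test'[OF sm])
        fix m
        have "\<bar>a m * c k m * s ^ m\<bar> = c k m * \<bar>a m * s ^ m\<bar>" using c by (simp add: abs_mult)
        also have "\<dots> \<le> \<bar>a m * s ^ m\<bar>" using c by (simp add: mult_left_le_one_le)
        finally show "norm (a m * c k m * s ^ m) \<le> \<bar>a m * S ^ m\<bar>" using le[of m] by simp
      qed
      have s3: "summable (\<lambda>m. \<bar>a m * S ^ m\<bar> * (1 - c k m))"
        by (rule summable_comparison_test'[OF sm]) (use c bd in \<open>simp add: abs_mult\<close>)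
      have le3: "norm (a m * c k m * s ^ m - a m * s ^ m) \<le> \<bar>a m * S ^ m\<bar> * (1 - c k m)" for m
      proof -
        have "a m * c k m * s ^ m - a m * s ^ m = - ((a m * s ^ m) * (1 - c k m))"
          by (simp add: algebra_simps)
        hence "norm (a m * c k m * s ^ m - a m * s ^ m) = \<bar>a m * s ^ m\<bar> * (1 - c k m)"
          using c by (simp add: abs_mult)
        thus ?thesis using le c by (simp add: mult_right_mono)
      qed
      have "dist (\<Sum>m. a m * c k m * s ^ m) (\<Sum>m. a m * s ^ m) =
          norm (\<Sum>m. a m * c k m * s ^ m - a m * s ^ m)"
        unfolding dist_norm suminf_diff[OF s2 s1] ..
      also have "\<dots> \<le> \<delta> k" unfolding \<delta>_def by (intro norm_suminf_le le3 s3)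
      finally show "dist (\<Sum>m. a m * c k m * s ^ m) (\<Sum>m. a m * s ^ m) < e" using elim by simp
    qed
  qed
qed

subsection \<open>Mehler--Heine asymptotics\<close>

text \<open>For k > 0 this is the factor by which the coefficients in the scaled variable s =
  \<lambda>_k w differ from those of the Bessel limit; see
  \<open>ultra_coeff_conv_bessel\<close>.\<close>

definition ultra_damp :: "real \<Rightarrow> nat \<Rightarrow> nat \<Rightarrow> real" where
  "ultra_damp \<alpha> k m = (\<Prod>i<m. 1 - jacobi_ev \<alpha> i / jacobi_ev \<alpha> k)"

text \<open>For m \<le> k every factor lies in [0, 1]. For m > k > 0 later factors may be negative,
  but the factor with i = k is 0.\<close>

lemma ultra_damp_bounds:
  assumes "\<alpha> > -1"
  shows "0 \<le> ultra_damp \<alpha> k m" "ultra_damp \<alpha> k m \<le> 1"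
proof -
  have "0 \<le> ultra_damp \<alpha> k m \<and> ultra_damp \<alpha> k m \<le> 1"
  proof (cases "k = 0")
    \<comment> \<open>Here the denominator is 0, so each quotient is 0 by convention and the product
      is 1.\<close>
    case True
    thus ?thesis by (simp add: ultra_damp_def)
  next
    case False
    hence l: "jacobi_ev \<alpha> k > 0" using assms by (intro jacobi_ev_pos) auto
    show ?thesis
    proof (cases "m \<le> k")
      case True
      have "0 \<le> 1 - jacobi_ev \<alpha> i / jacobi_ev \<alpha> k \<and> 1 - jacobi_ev \<alpha> i / jacobi_ev \<alpha> k \<le> 1"
        if "i < m" for i
        using jacobi_ev_less[OF assms, of i k] jacobi_ev_pos[OF assms, of i] that True l
        by (cases "i = 0") auto
      thus ?thesis unfolding ultra_damp_def by (auto intro!: prod_nonneg prod_le_1)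
    next
      case False
      hence "ultra_damp \<alpha> k m = 0" using l by (auto simp: ultra_damp_def)
      thus ?thesis by simp
    qed
  qed
  thus "0 \<le> ultra_damp \<alpha> k m" "ultra_damp \<alpha> k m \<le> 1" by auto
qed

lemma filterlim_jacobi_ev: "filterlim (jacobi_ev \<alpha>) at_top sequentially"
  unfolding jacobi_ev_def[abs_def] by real_asymp

lemma tendsto_ultra_damp: "(\<lambda>k. ultra_damp \<alpha> k m) \<longlonglongrightarrow> 1"
proof -
  have "(\<lambda>k. \<Prod>i<m. 1 - jacobi_ev \<alpha> i / jacobi_ev \<alpha> k) \<longlonglongrightarrow> (\<Prod>i<m. 1 - 0)"
    by (intro tendsto_prod tendsto_diff tendsto_const tendsto_divide_0[OF tendsto_const]
        filterlim_at_top_imp_at_infinity filterlim_jacobi_ev)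
  thus ?thesis by (simp add: ultra_damp_def)
qed

lemma ultra_coeff_conv_bessel:
  assumes "\<alpha> > -1" "k > 0"
  shows "ultra_coeff \<alpha> k m = bessel_coeff (\<alpha> + 1) m * ultra_damp \<alpha> k m * jacobi_ev \<alpha> k ^ m"
proof -
  have "jacobi_ev \<alpha> i - jacobi_ev \<alpha> k = (- 1) * jacobi_ev \<alpha> k * (1 - jacobi_ev \<alpha> i / jacobi_ev \<alpha> k)" for i
    using jacobi_ev_pos[OF assms] by (simp add: algebra_simps)
  hence "(\<Prod>i<m. jacobi_ev \<alpha> i - jacobi_ev \<alpha> k) = (- 1) ^ m * jacobi_ev \<alpha> k ^ m * ultra_damp \<alpha> k m"
    by (simp only: prod.distrib prod_constant card_lessThan ultra_damp_def)
  thus ?thesis by (simp add: ultra_coeff_def bessel_coeff_def mult_ac)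
qed

lemma poly_conv_suminf:
  fixes p :: "real poly"
  shows "poly p x = (\<Sum>m. coeff p m * x ^ m)"
  unfolding poly_altdef by (rule suminf_finite[symmetric]) (auto simp: not_le coeff_eq_0)

lemma ultra_poly_scaled:
  assumes "\<alpha> > -1" "k > 0"
  shows "poly (ultra_poly \<alpha> k) (s / jacobi_ev \<alpha> k) =
    (\<Sum>m. bessel_coeff (\<alpha> + 1) m * ultra_damp \<alpha> k m * s ^ m)"
  unfolding poly_conv_suminf using jacobi_ev_pos[OF assms]
  by (simp add: ultra_coeff_conv_bessel[OF assms] power_divide mult.assoc)

text \<open>The left side is the s-derivative of the rescaled polynomial, which explains the
  division by \<open>jacobi_ev \<alpha> k\<close> and the shifted index of
  \<open>ultra_damp\<close>.\<close>

lemma ultra_poly_pderiv_scaled: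
  assumes "\<alpha> > -1" "k > 0"
  shows "poly (pderiv (ultra_poly \<alpha> k)) (s / jacobi_ev \<alpha> k) / jacobi_ev \<alpha> k =
    (\<Sum>m. diffs (bessel_coeff (\<alpha> + 1)) m * ultra_damp \<alpha> k (Suc m) * s ^ m)"
proof -
  let ?l = "jacobi_ev \<alpha> k"
  have l: "?l > 0" by (rule jacobi_ev_pos[OF assms])
  have "coeff (pderiv (ultra_poly \<alpha> k)) m * (s / ?l) ^ m =
      ?l * (diffs (bessel_coeff (\<alpha> + 1)) m * ultra_damp \<alpha> k (Suc m) * s ^ m)" for m
    using l by (simp add: coeff_pderiv ultra_coeff_conv_bessel[OF assms] diffs_def power_divide)
  hence "poly (pderiv (ultra_poly \<alpha> k)) (s / ?l) =
      (\<Sum>m. ?l * (diffs (bessel_coeff (\<alpha> + 1)) m * ultra_damp \<alpha> k (Suc m) * s ^ m))"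
    unfolding poly_conv_suminf by simp
  also have "\<dots> = ?l * (\<Sum>m. diffs (bessel_coeff (\<alpha> + 1)) m * ultra_damp \<alpha> k (Suc m) * s ^ m)"
  proof (rule suminf_mult)
    have "summable (\<lambda>m. \<bar>diffs (bessel_coeff (\<alpha> + 1)) m * s ^ m\<bar>)"
      using summable_mult[OF summable_abs_bessel[of "\<alpha> + 2" s], of "1 / (\<alpha> + 1)"] assms(1)
      by (simp add: diffs_bessel_coeff abs_mult add.assoc)
    moreover have "norm (diffs (bessel_coeff (\<alpha> + 1)) m * ultra_damp \<alpha> k (Suc m) * s ^ m)
        \<le> \<bar>diffs (bessel_coeff (\<alpha> + 1)) m * s ^ m\<bar>" for m
    proof -
      have "norm (diffs (bessel_coeff (\<alpha> + 1)) m * ultra_damp \<alpha> k (Suc m) * s ^ m) =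
          ultra_damp \<alpha> k (Suc m) * \<bar>diffs (bessel_coeff (\<alpha> + 1)) m * s ^ m\<bar>"
        using ultra_damp_bounds[OF assms(1)] by (simp add: abs_mult)
      thus ?thesis using ultra_damp_bounds[OF assms(1)] by (simp add: mult_left_le_one_le)
    qed
    ultimately show "summable (\<lambda>m. diffs (bessel_coeff (\<alpha> + 1)) m * ultra_damp \<alpha> k (Suc m) * s ^ m)"
      by (rule summable_comparison_test')
  qed
  finally show ?thesis using l by simp
qed

lemma mehler_heine:
  assumes "\<alpha> > -1"
  shows "uniform_limit {-S..S} (\<lambda>k s. poly (ultra_poly \<alpha> k) (s / jacobi_ev \<alpha> k))
    (bessel_entire (\<alpha> + 1)) sequentially"
proof -
  have "uniform_limit {-S..S} (\<lambda>k s. \<Sum>m. bessel_coeff (\<alpha> + 1) m * ultra_damp \<alpha> k m * s ^ m)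
      (\<lambda>s. \<Sum>m. bessel_coeff (\<alpha> + 1) m * s ^ m) sequentially"
    using assms ultra_damp_bounds[OF assms]
    by (intro uniform_limit_powser_multiplier summable_abs_bessel tendsto_ultra_damp) auto
  \<comment> \<open>The case k = 0, where the scaling divides by 0, is excluded by passing to large
    k.\<close>
  moreover have "\<forall>\<^sub>F k in sequentially. \<forall>s\<in>{-S..S}.
      (\<Sum>m. bessel_coeff (\<alpha> + 1) m * ultra_damp \<alpha> k m * s ^ m) =
      poly (ultra_poly \<alpha> k) (s / jacobi_ev \<alpha> k)"
    using eventually_gt_at_top[of 0] by eventually_elim (simp add: ultra_poly_scaled[OF assms])
  ultimately show ?thesis
    by (subst (asm) uniform_limit_cong) (auto simp: bessel_entire_def)
qed

lemma mehler_heine_pderiv: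
  assumes "\<alpha> > -1"
  shows "(\<lambda>k. poly (pderiv (ultra_poly \<alpha> k)) (s / jacobi_ev \<alpha> k) / jacobi_ev \<alpha> k)
    \<longlonglongrightarrow> - bessel_entire (\<alpha> + 2) s / (\<alpha> + 1)"
proof -
  have "summable (\<lambda>m. \<bar>diffs (bessel_coeff (\<alpha> + 1)) m * \<bar>s\<bar> ^ m\<bar>)"
    using summable_mult[OF summable_abs_bessel[of "\<alpha> + 2" "\<bar>s\<bar>"], of "1 / (\<alpha> + 1)"] assms(1)
    by (simp add: diffs_bessel_coeff abs_mult add.assoc)
  hence "uniform_limit {-\<bar>s\<bar>..\<bar>s\<bar>}
      (\<lambda>k s. \<Sum>m. diffs (bessel_coeff (\<alpha> + 1)) m * ultra_damp \<alpha> k (Suc m) * s ^ m)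
      (\<lambda>s. \<Sum>m. diffs (bessel_coeff (\<alpha> + 1)) m * s ^ m) sequentially"
    using assms ultra_damp_bounds[OF assms]
    by (intro uniform_limit_powser_multiplier tendsto_ultra_damp) auto
  hence "(\<lambda>k. \<Sum>m. diffs (bessel_coeff (\<alpha> + 1)) m * ultra_damp \<alpha> k (Suc m) * s ^ m)
      \<longlonglongrightarrow> (\<Sum>m. diffs (bessel_coeff (\<alpha> + 1)) m * s ^ m)"
    by (rule tendsto_uniform_limitI) auto
  moreover have "(\<Sum>m. diffs (bessel_coeff (\<alpha> + 1)) m * s ^ m) = - bessel_entire (\<alpha> + 2) s / (\<alpha> + 1)"
    using bessel_entire_diffs[of "\<alpha> + 1" s] assms by (simp add: add.assoc)
  moreover have "\<forall>\<^sub>F k in sequentially.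
      (\<Sum>m. diffs (bessel_coeff (\<alpha> + 1)) m * ultra_damp \<alpha> k (Suc m) * s ^ m) =
      poly (pderiv (ultra_poly \<alpha> k)) (s / jacobi_ev \<alpha> k) / jacobi_ev \<alpha> k"
    using eventually_gt_at_top[of 0] by eventually_elim (simp add: ultra_poly_pderiv_scaled[OF assms])
  ultimately show ?thesis by (simp add: tendsto_cong)
qed

text \<open>In the scaled variable the derivative part of the energy is \<sigma> (1 -
  \<sigma>/\<lambda>_k) times the square of the s-derivative. That derivative tends to 0, since
  \<sigma> is a critical point of the limit function.\<close>

lemma ultra_energy_scaled_tendsto:
  assumes "\<alpha> > -1" and zero: "bessel_entire (\<alpha> + 2) \<sigma> = 0"
  shows "(\<lambda>k. ultra_energy \<alpha> k (\<sigma> / jacobi_ev \<alpha> k)) \<longlonglongrightarrow> (bessel_entire (\<alpha> + 1) \<sigma>)\<^sup>2"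
proof -
  define q where "q = (\<lambda>k. poly (ultra_poly \<alpha> k) (\<sigma> / jacobi_ev \<alpha> k))"
  define q' where "q' = (\<lambda>k. poly (pderiv (ultra_poly \<alpha> k)) (\<sigma> / jacobi_ev \<alpha> k) / jacobi_ev \<alpha> k)"
  have "q \<longlonglongrightarrow> bessel_entire (\<alpha> + 1) \<sigma>"
    unfolding q_def by (rule tendsto_uniform_limitI[OF mehler_heine[OF assms(1), of "\<bar>\<sigma>\<bar>"]]) auto
  moreover have "q' \<longlonglongrightarrow> 0"
    unfolding q'_def using mehler_heine_pderiv[OF assms(1), of \<sigma>] zero by simp
  moreover have "(\<lambda>k. \<sigma> / jacobi_ev \<alpha> k) \<longlonglongrightarrow> 0"
    by (intro tendsto_divide_0[OF tendsto_const] filterlim_at_top_imp_at_infinity filterlim_jacobi_ev)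
  ultimately have "(\<lambda>k. (q k)\<^sup>2 + \<sigma> * (1 - \<sigma> / jacobi_ev \<alpha> k) * (q' k)\<^sup>2)
      \<longlonglongrightarrow> (bessel_entire (\<alpha> + 1) \<sigma>)\<^sup>2 + \<sigma> * (1 - 0) * 0\<^sup>2"
    by (intro tendsto_intros)
  moreover have "ultra_energy \<alpha> k (\<sigma> / jacobi_ev \<alpha> k) =
      (q k)\<^sup>2 + \<sigma> * (1 - \<sigma> / jacobi_ev \<alpha> k) * (q' k)\<^sup>2" for k
    by (simp add: ultra_energy_def q_def q'_def power_divide power2_eq_square)
  ultimately show ?thesis by simp
qed

subsection \<open>The limit of the minimum\<close>

text \<open>At \<sigma> the contiguous relation reads \<sigma> B'(\<sigma>) = c A(\<sigma>) with A =
  \<open>bessel_entire c\<close> and B = \<open>bessel_entire (c + 1)\<close>. A positive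
  A(\<sigma>) would make B negative just before its first zero.\<close>

lemma bessel_entire_nonpos_at_zero:
  assumes "c > 0" "\<sigma> > 0" and zero: "bessel_entire (c + 1) \<sigma> = 0"
    and pos: "\<And>s. 0 \<le> s \<Longrightarrow> s < \<sigma> \<Longrightarrow> bessel_entire (c + 1) s > 0"
  shows "bessel_entire c \<sigma> \<le> 0"
proof (rule ccontr)
  assume "\<not> ?thesis"
  hence "c * (bessel_entire c \<sigma> - bessel_entire (c + 1) \<sigma>) / \<sigma> > 0"
    using assms by simp
  from DERIV_pos_inc_left[OF DERIV_bessel_entire_Suc[OF assms(1,2)] this]
  obtain d where d: "d > 0" "\<And>h. h > 0 \<Longrightarrow> h < d \<Longrightarrow> bessel_entire (c + 1) (\<sigma> - h) < 0"
    using zero by auto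
  \<comment> \<open>The cap at \<sigma> keeps \<sigma> - h in the range where positivity is
    known.\<close>
  define h where "h = min (d / 2) \<sigma>"
  have "h > 0" "h < d" "h \<le> \<sigma>" using d(1) assms(2) by (auto simp: h_def)
  with d(2)[of h] pos[of "\<sigma> - h"] show False by auto
qed

lemma bessel_entire_antimono_to_zero:
  assumes "c > 0" and zero: "bessel_entire (c + 1) \<sigma> = 0"
    and pos: "\<And>s. 0 \<le> s \<Longrightarrow> s < \<sigma> \<Longrightarrow> bessel_entire (c + 1) s > 0"
    and s: "0 \<le> s" "s \<le> \<sigma>"
  shows "bessel_entire c \<sigma> \<le> bessel_entire c s"
proof (rule DERIV_nonpos_imp_nonincreasing[OF s(2)])
  fix x assume "s \<le> x" "x \<le> \<sigma>"
  hence "bessel_entire (c + 1) x \<ge> 0" using zero pos[of x] s by (cases "x = \<sigma>") auto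
  thus "\<exists>y. (bessel_entire c has_real_derivative y) (at x) \<and> y \<le> 0"
    using DERIV_bessel_entire[OF assms(1), of x] assms(1) by (intro exI conjI) auto
qed

text \<open>One threshold K serves all w in [0, 1/2]: for k \<ge> K the Mehler-Heine limit covers w
  \<le> \<sigma>/\<lambda>_k and the energy covers larger w. The finitely many k < K are close to
  their value 1 at w = 0.\<close>

lemma ultra_poly_lower_bound:
  assumes \<alpha>: "\<alpha> \<ge> -1/2" and "\<sigma> > 0" and zero: "bessel_entire (\<alpha> + 2) \<sigma> = 0"
    and pos: "\<And>s. 0 \<le> s \<Longrightarrow> s < \<sigma> \<Longrightarrow> bessel_entire (\<alpha> + 2) s > 0" and "\<epsilon> > 0"
  shows "\<forall>\<^sub>F w in at_right 0. \<forall>k. bessel_entire (\<alpha> + 1) \<sigma> - \<epsilon> \<le> poly (ultra_poly \<alpha> k) w"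
proof -
  define m where "m = bessel_entire (\<alpha> + 1) \<sigma>"
  have \<alpha>1: "\<alpha> > -1" "\<alpha> + 1 > 0" and \<alpha>2: "\<alpha> + 1 + 1 = \<alpha> + 2" using \<alpha> by auto
  have m0: "m \<le> 0"
    unfolding m_def using bessel_entire_nonpos_at_zero[OF \<alpha>1(2) assms(2)] zero pos \<alpha>2 by simp
  have anti: "m \<le> bessel_entire (\<alpha> + 1) s" if "0 \<le> s" "s \<le> \<sigma>" for s
    unfolding m_def using bessel_entire_antimono_to_zero[OF \<alpha>1(2), of \<sigma> s] zero pos \<alpha>2 that by simp
  \<comment> \<open>The sign m \<le> 0 is essential: it turns the energy bound on |P_k| into the
    wanted lower bound for P_k.\<close>
  have "m\<^sup>2 < (m - \<epsilon>)\<^sup>2"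
    using m0 assms(5) by (intro power2_strict_mono) auto
  have "\<forall>\<^sub>F k in sequentially. \<forall>w\<in>{0..1/2}. m - \<epsilon> \<le> poly (ultra_poly \<alpha> k) w"
    using uniform_limitD[OF mehler_heine[OF \<alpha>1(1), of \<sigma>] assms(5)]
      order_tendstoD(2)[OF ultra_energy_scaled_tendsto[OF \<alpha>1(1) zero] \<open>m\<^sup>2 < (m - \<epsilon>)\<^sup>2\<close>[unfolded m_def]]
      eventually_gt_at_top[of 0]
  proof eventually_elim
    case (elim k)
    let ?l = "jacobi_ev \<alpha> k"
    have l: "?l > 0" using elim \<alpha>1 by (intro jacobi_ev_pos)
    show ?case
    proof
      fix w :: real assume w: "w \<in> {0..1/2}"
      show "m - \<epsilon> \<le> poly (ultra_poly \<alpha> k) w"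
      proof (cases "w \<le> \<sigma> / ?l")
        case True
        define s where "s = w * ?l"
        have s: "0 \<le> s" "s \<le> \<sigma>" using True w l by (auto simp: s_def field_simps)
        have "dist (poly (ultra_poly \<alpha> k) (s / ?l)) (bessel_entire (\<alpha> + 1) s) < \<epsilon>"
          using elim(1) s by auto
        moreover have "s / ?l = w" using l by (simp add: s_def)
        ultimately show ?thesis using anti[OF s] by (simp add: dist_real_def)
      next
        case False
        have "(poly (ultra_poly \<alpha> k) w)\<^sup>2 \<le> ultra_energy \<alpha> k w"
          using w \<alpha>1 by (intro ultra_poly_sq_le_energy) auto
        also have "\<dots> \<le> ultra_energy \<alpha> k (\<sigma> / ?l)"
          using w \<alpha> False elim by (intro ultra_energy_antimono) auto
        also have "\<dots> \<le> (m - \<epsilon>)\<^sup>2" using elim by (simp add: m_def)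
        finally have "\<bar>poly (ultra_poly \<alpha> k) w\<bar> \<le> \<bar>m - \<epsilon>\<bar>" by (simp add: abs_le_square_iff)
        thus ?thesis using m0 assms(5) by linarith
      qed
    qed
  qed
  then obtain K where K: "\<And>k w. k \<ge> K \<Longrightarrow> w \<in> {0..1/2} \<Longrightarrow> m - \<epsilon> \<le> poly (ultra_poly \<alpha> k) w"
    unfolding eventually_sequentially by blast
  have small: "\<forall>\<^sub>F w in at_right 0. m - \<epsilon> < poly (ultra_poly \<alpha> k) w" for k
  proof (rule order_tendstoD)
    have "isCont (poly (ultra_poly \<alpha> k)) 0" by simp
    thus "(poly (ultra_poly \<alpha> k) \<longlongrightarrow> 1) (at_right 0)"
      using ultra_poly_at_0[of \<alpha> k] by (metis filterlim_at_split isCont_def)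
    show "m - \<epsilon> < 1" using m0 assms(5) by simp
  qed
  have "\<forall>\<^sub>F w in at_right 0. \<forall>k\<in>{..<K}. m - \<epsilon> < poly (ultra_poly \<alpha> k) w"
    using small by (intro eventually_ball_finite) auto
  moreover have "\<forall>\<^sub>F w in at_right 0. w \<in> {0<..<1/2::real}"
    by (rule eventually_at_right_real) simp
  ultimately show ?thesis
  proof eventually_elim
    case (elim w)
    show ?case
    proof
      fix k
      show "bessel_entire (\<alpha> + 1) \<sigma> - \<epsilon> \<le> poly (ultra_poly \<alpha> k) w"
        using elim K[of k w] unfolding m_def by (cases "k < K") (auto simp: not_less intro: less_imp_le)
    qed
  qed
qed

text \<open>For given w a degree k is chosen for which the scaled variable \<lambda>_k w is close to
  \<sigma>.\<close>

lemma ultra_poly_upper_bound: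
  assumes \<alpha>: "\<alpha> > -1" and "\<sigma> > 0" "\<epsilon> > 0"
  shows "\<forall>\<^sub>F w in at_right 0. \<exists>k. poly (ultra_poly \<alpha> k) w \<le> bessel_entire (\<alpha> + 1) \<sigma> + \<epsilon>"
proof -
  let ?A = "bessel_entire (\<alpha> + 1)"
  define X where "X = (\<lambda>w. sqrt (\<sigma> / w))"
  \<comment> \<open>Since \<lambda>_k grows like k^2, rounding the square root of \<sigma>/w down to
    an integer still gives \<lambda>_k w \<rightarrow> \<sigma>.\<close>
  define k where "k = (\<lambda>w. nat \<lfloor>X w\<rfloor>)"
  define s where "s = (\<lambda>w. w * jacobi_ev \<alpha> (k w))"
  have X: "filterlim X at_top (at_right 0)"
    unfolding X_def using assms(2) by real_asymp
  have "filterlim (\<lambda>x. nat \<lfloor>x::real\<rfloor>) at_top at_top" by real_asymp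
  hence k: "filterlim k at_top (at_right 0)"
    unfolding k_def using X by (rule filterlim_compose)
  have "((\<lambda>x. real (nat \<lfloor>x\<rfloor>) * (real (nat \<lfloor>x\<rfloor>) + 2 * \<alpha> + 1) / x\<^sup>2) \<longlongrightarrow> 1) at_top"
    by real_asymp
  from tendsto_mult[OF tendsto_const filterlim_compose[OF this X], of \<sigma>]
  have "((\<lambda>w. \<sigma> * (jacobi_ev \<alpha> (k w) / (X w)\<^sup>2)) \<longlongrightarrow> \<sigma>) (at_right 0)"
    by (simp add: jacobi_ev_def k_def)
  moreover have "\<forall>\<^sub>F w in at_right 0. \<sigma> * (jacobi_ev \<alpha> (k w) / (X w)\<^sup>2) = s w"
    using eventually_at_right_less[of 0] by eventually_elim (use assms(2) in \<open>simp add: X_def s_def\<close>)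
  ultimately have s: "(s \<longlongrightarrow> \<sigma>) (at_right 0)" by (simp add: tendsto_cong)
  have As: "((\<lambda>w. ?A (s w)) \<longlongrightarrow> ?A \<sigma>) (at_right 0)"
    using isCont_tendsto_compose[OF isCont_bessel_entire s] \<alpha> by simp
  have e2: "\<epsilon> / 2 > 0" using assms(3) by simp
  have lt: "?A \<sigma> < ?A \<sigma> + \<epsilon> / 2" using e2 by simp
  \<comment> \<open>The values s w may exceed \<sigma>, hence the interval up to \<sigma> + 1. One
    half of \<epsilon> pays for the uniform approximation, the other for continuity at
    \<sigma>.\<close>
  note mh = uniform_limitD[OF mehler_heine[OF \<alpha>, of "\<sigma> + 1"] e2]
  from eventually_compose_filterlim[OF mh k] eventually_compose_filterlim[OF eventually_gt_at_top[of 0] k]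
    order_tendstoD(1)[OF s assms(2)] order_tendstoD(2)[OF s, of "\<sigma> + 1", OF less_add_one]
    order_tendstoD(2)[OF As lt]
  have "\<forall>\<^sub>F w in at_right 0. poly (ultra_poly \<alpha> (k w)) w \<le> ?A \<sigma> + \<epsilon>"
  proof eventually_elim
    case (elim w)
    have "jacobi_ev \<alpha> (k w) > 0" using elim \<alpha> by (intro jacobi_ev_pos) auto
    hence "s w / jacobi_ev \<alpha> (k w) = w" by (simp add: s_def)
    moreover have "dist (poly (ultra_poly \<alpha> (k w)) (s w / jacobi_ev \<alpha> (k w))) (?A (s w)) < \<epsilon> / 2"
      using elim by simp
    ultimately have "\<bar>poly (ultra_poly \<alpha> (k w)) w - ?A (s w)\<bar> < \<epsilon> / 2"
      by (simp add: dist_real_def)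
    thus ?case using elim by linarith
  qed
  thus ?thesis by (rule eventually_mono) blast
qed

lemma jacobi_min_conv_ultra:
  "\<alpha> > -1 \<Longrightarrow> jacobi_min \<alpha> t = (INF k. poly (ultra_poly \<alpha> k) ((1 - t) / 2))"
  by (simp add: jacobi_min_def jacobi_poly_conv_ultra)

lemma jacobi_min_tendsto:
  assumes \<alpha>: "\<alpha> \<ge> -1/2" and "\<sigma> > 0" and zero: "bessel_entire (\<alpha> + 2) \<sigma> = 0"
    and pos: "\<And>s. 0 \<le> s \<Longrightarrow> s < \<sigma> \<Longrightarrow> bessel_entire (\<alpha> + 2) s > 0"
  shows "(jacobi_min \<alpha> \<longlongrightarrow> bessel_entire (\<alpha> + 1) \<sigma>) (at_left 1)"
proof (rule tendstoI)
  fix e :: real assume e: "e > 0"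
  let ?m = "bessel_entire (\<alpha> + 1) \<sigma>"
  have \<alpha>1: "\<alpha> > -1" and e2: "e / 2 > 0" using \<alpha> e by auto
  have w: "filterlim (\<lambda>t::real. (1 - t) / 2) (at_right 0) (at_left 1)" by real_asymp
  have lower: "\<forall>\<^sub>F w in at_right 0. \<forall>k. ?m - e / 2 \<le> poly (ultra_poly \<alpha> k) w"
    by (intro ultra_poly_lower_bound assms e2)
  have "\<forall>\<^sub>F w in at_right 0. dist (INF k. poly (ultra_poly \<alpha> k) w) ?m < e"
    using lower ultra_poly_upper_bound[OF \<alpha>1 assms(2) e2]
      eventually_at_right_real[of 0 "1/2 :: real", simplified]
  proof eventually_elim
    case (elim w)
    from elim(2) obtain k where "poly (ultra_poly \<alpha> k) w \<le> ?m + e / 2" by blast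
    \<comment> \<open>A real infimum is meaningful only for a set bounded below; the upper estimate
      through a single k depends on this.\<close>
    moreover have "bdd_below (range (\<lambda>k. poly (ultra_poly \<alpha> k) w))"
      using elim ultra_poly_ge_minus_1[OF \<alpha>, of w] by (intro bdd_belowI[of _ "-1"]) auto
    ultimately have "(INF k. poly (ultra_poly \<alpha> k) w) \<le> ?m + e / 2"
      by (intro cINF_lower2[of _ _ k]) auto
    moreover have "?m - e / 2 \<le> (INF k. poly (ultra_poly \<alpha> k) w)"
      using elim by (intro cINF_greatest) auto
    ultimately show ?case using e by (simp add: dist_real_def abs_less_iff)
  qed
  from eventually_compose_filterlim[OF this w]
  show "\<forall>\<^sub>F t in at_left 1. dist (jacobi_min \<alpha> t) ?m < e"
    by (simp add: jacobi_min_conv_ultra[OF \<alpha>1])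
qed

theorem theorem8p1:
  fixes n :: nat and \<alpha> :: real
  assumes "n \<ge> 2"
    and "\<alpha> = (real n - 3) / 2"
  shows "(jacobi_min \<alpha> \<longlongrightarrow>
           2 powr \<alpha> * Gamma (\<alpha> + 1) *
             (bessel_J \<alpha> (bessel_first_zero (\<alpha> + 1)) / bessel_first_zero (\<alpha> + 1) powr \<alpha>))
         (at_left 1)"
proof -
  \<comment> \<open>The condition n \<ge> 2 is exactly what Sonine's monotonicity requires of
    \<alpha>.\<close>
  have \<alpha>: "\<alpha> \<ge> -1/2" "\<alpha> + 1 > 0" "\<alpha> + 1 + 1 = \<alpha> + 2" using assms by auto
  obtain \<sigma> where \<sigma>: "\<sigma> > 0" "bessel_first_zero (\<alpha> + 1) = 2 * sqrt \<sigma>"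
    "bessel_entire (\<alpha> + 2) \<sigma> = 0" "\<And>s. 0 \<le> s \<Longrightarrow> s < \<sigma> \<Longrightarrow> bessel_entire (\<alpha> + 2) s > 0"
    using bessel_first_zeroE[OF \<alpha>(2)] unfolding \<alpha>(3) by blast
  define j where "j = bessel_first_zero (\<alpha> + 1)"
  have j: "j > 0" "j\<^sup>2 / 4 = \<sigma>" using \<sigma>(1,2) by (simp_all add: j_def power_mult_distrib)
  \<comment> \<open>The prefactor (j/2)^\<alpha> / Gamma(\<alpha> + 1) of the Bessel function
    cancels against the constants of the claim.\<close>
  have "2 powr \<alpha> * Gamma (\<alpha> + 1) * (bessel_J \<alpha> j / j powr \<alpha>) = bessel_entire (\<alpha> + 1) \<sigma>"
  proof -
    have "Gamma (\<alpha> + 1) \<noteq> 0" using Gamma_real_pos[OF \<alpha>(2)] by linarith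
    thus ?thesis using j \<alpha>(2) by (simp add: bessel_J_conv_entire powr_divide)
  qed
  moreover have "(jacobi_min \<alpha> \<longlongrightarrow> bessel_entire (\<alpha> + 1) \<sigma>) (at_left 1)"
    by (intro jacobi_min_tendsto \<alpha>(1) \<sigma>)
  ultimately show ?thesis by (simp add: j_def)
qed

end
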